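(* Let $(\tilde X,\tilde d,\tilde\ll,\tilde\leq,\tilde\tau)$ be an extension of $(X,d,\ll,\leq,\tau)$, where both are Lorentzian length spaces, and denote the corresponding isometry by $\iota$. Then there is a $\tilde\ll$-timelike curve $\tilde\gamma\colon[0,1]\to\tilde X$ (future- or past-directed) such that $\tilde\gamma([0,1))\subseteq\iota(X)$ and $\tilde\gamma(1)\in\tilde X\setminus\iota(X)$, i.e., $\partial^+(X)\cup\partial^-(X)\neq\emptyset$.
   Context: **Lorentzian pre-length spaces.** A causal space is a set $X$ with a preorder $\leq$ and a transitive relation $\ll$ contained in $\leq$; $x<y$ means $x\leq y$ and $x\neq y$; $I^+(x)=\{y: x\ll y\}$, $I^-(x)=\{y:y\ll x\}$. If $X$ also carries a metric $d$ and a lower semicontinuous $\tau\colon X\times X\to[0,\infty]$ with $\tau(x,z)\geq\tau(x,y)+\tau(y,z)$ for all $x\le y\le z$, $\tau(x,y)=0$ if $x\nleq y$, and $\tau(x,y)>0\Leftrightarrow x\ll y$, then $(X,d,\ll,\leq,\tau)$ is a Lorentzian pre-length space. A non-constant curve $\gamma\colon I\to X$ is future-directed causal (timelike) if it is locally Lipschitz with respect to $d$ and $\gamma(t_1)\leq\gamma(t_2)$ ($\gamma(t_1)\ll\gamma(t_2)$) for all $t_1<t_2$ in $I$; past-directed with the relations reversed. For $\gamma\colon[a,b]\to X$ future-directed causal, $L_\tau(\gamma):=\inf\{\sum_{i=0}^{N-1}\tau(\gamma(t_i),\gamma(t_{i+1})) : a=t_0<\dots<t_N=b,\ N\in\mathbb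 N\}$; for $[a,b)$ one uses partitions with $a=t_0<\dots<t_N<b$, and similarly in the other cases. **Lorentzian length spaces.** $X$ is localisable if every $x\in X$ has an open (localising) neighbourhood $\Omega_x$ such that: (i) the $d$-length of all causal curves contained in $\Omega_x$ is uniformly bounded; (ii) there is a continuous map $\omega_x\colon\Omega_x\times\Omega_x\to[0,\infty)$ such that $\Omega_x$ with the restrictions of $d,\ll,\leq$ and with $\omega_x$ is a Lorentzian pre-length space, and $I^\pm(y)\cap\Omega_x\neq\emptyset$ for every $y\in\Omega_x$; (iii) for all $p,q\in\Omega_x$ with $p<q$ there is a future-directed causal curve $\gamma_{p,q}$ from $p$ to $q$ that is maximal in $\Omega_x$ (has maximal $L_\tau$ among future-directed causal curves in $\Omega_x$ from $p$ to $q$) and satisfies $L_\tau(\gamma_{p,q})=\omega_x(p,q)\leq\tau(p,q)$. $X$ is causally path connected if for $x\ll y$ (resp. $x<y$) there is a future-directed timelike (resp. causal) curve from $x$ to $y$. $X$ is locally causally closed if every point has a neighbourhood $U$ such that $\leq$ is closed in $\bar U\times\bar U$. Let $\mathcal T(x,y):=\sup\{L_\tau(\gamma):\gamma\text{ future-directed causal from }x\text{ to }y\}$ if such curves exist, and $0$ otherwise. A Lorentzian length space is a locally causally closed, causally path connected, localisable Lorentzian pre-length space with $\tau=\mathcal T$. **Extensions.** A Lorentzian pre-length space $(\tilde X,\tilde d,\tilde\ll,\tilde\leq,\tilde\tau)$ is an extension of $(X,d,\ll,\leq,\tau)$ if: (i) $(\tilde X,\tilde d)$ is connected; (ii) there is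 an isometry $\iota\colon(X,d)\to(\tilde X,\tilde d)$ of metric spaces (not required to be onto); (iii) $\iota(X)$ is a proper, open subset of $\tilde X$; (iv) $x\leq y\Rightarrow\iota(x)\,\tilde\leq\,\iota(y)$ and $x\ll y\Rightarrow\iota(x)\,\tilde\ll\,\iota(y)$; (v) a curve $\gamma\colon I\to X$ is timelike (resp. causal) if and only if $\iota\circ\gamma$ is timelike (resp. causal) in $\tilde X$, and $L_\tau(\gamma)=L_{\tilde\tau}(\iota\circ\gamma)$ for every causal curve $\gamma\colon I\to X$. Spaces are non-empty. **Boundary.** The future/past boundary $\partial^+(X)$/$\partial^-(X)$ of $X$ (with respect to the extension) is the set of all points $\tilde p\in\partial\iota(X)$ that can be reached by a future/past directed $\tilde\ll$-timelike curve $\gamma\colon[0,1]\to\tilde X$ such that $\gamma([0,1))\subseteq\iota(X)$ and $\gamma(1)=\tilde p$. *)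

theory Defs
  imports "HOL-Analysis.Analysis"
begin

(* The underlying set is mspace (lmetric S).  The two relations and the time separation are
   total functions on the ambient type, but only their values on that set are ever used. *)
record 'a lorentzian =
  lmetric :: "'a metric"
  chron :: "'a \<Rightarrow> 'a \<Rightarrow> bool"  (infix \<open>\<lless>\<index>\<close> 50)
  causal :: "'a \<Rightarrow> 'a \<Rightarrow> bool"  (infix \<open>\<preceq>\<index>\<close> 50)
  tsep :: "'a \<Rightarrow> 'a \<Rightarrow> ennreal"  (\<open>\<tau>\<index>\<close>)

abbreviation points :: "'a lorentzian \<Rightarrow> 'a set" where
  "points S \<equiv> mspace (lmetric S)"

abbreviation ltop :: "'a lorentzian \<Rightarrow> 'a topology" where
  "ltop S \<equiv> mtopology_of (lmetric S)"

definition chron_future :: "'a lorentzian \<Rightarrow> 'a \<Rightarrow> 'a set" where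
  "chron_future S x = {y \<in> points S. x \<lless>\<^bsub>S\<^esub> y}"

definition chron_past :: "'a lorentzian \<Rightarrow> 'a \<Rightarrow> 'a set" where
  "chron_past S x = {y \<in> points S. y \<lless>\<^bsub>S\<^esub> x}"

(* Spaces are non-empty by convention. *)
definition causal_space :: "'a lorentzian \<Rightarrow> bool" where
  "causal_space S \<longleftrightarrow>
     points S \<noteq> {} \<and>
     reflp_on (points S) (causal S) \<and> transp_on (points S) (causal S) \<and>
     transp_on (points S) (chron S) \<and>
     (\<forall>x\<in>points S. \<forall>y\<in>points S. x \<lless>\<^bsub>S\<^esub> y \<longrightarrow> x \<preceq>\<^bsub>S\<^esub> y)"

definition lower_semicontinuous_map :: "'a topology \<Rightarrow> ('a \<Rightarrow> ennreal) \<Rightarrow> bool" where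
  "lower_semicontinuous_map X f \<longleftrightarrow> (\<forall>c. openin X {x \<in> topspace X. c < f x})"

definition lorentzian_pre_length_space :: "'a lorentzian \<Rightarrow> bool" where
  "lorentzian_pre_length_space S \<longleftrightarrow>
     causal_space S \<and>
     lower_semicontinuous_map (prod_topology (ltop S) (ltop S)) (\<lambda>(x, y). \<tau>\<^bsub>S\<^esub> x y) \<and>
     (\<forall>x\<in>points S. \<forall>y\<in>points S. \<forall>z\<in>points S.
        x \<preceq>\<^bsub>S\<^esub> y \<and> y \<preceq>\<^bsub>S\<^esub> z \<longrightarrow> \<tau>\<^bsub>S\<^esub> x y + \<tau>\<^bsub>S\<^esub> y z \<le> \<tau>\<^bsub>S\<^esub> x z) \<and>
     (\<forall>x\<in>points S. \<forall>y\<in>points S. \<not> x \<preceq>\<^bsub>S\<^esub> y \<longrightarrow> \<tau>\<^bsub>S\<^esub> x y = 0) \<and>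
     (\<forall>x\<in>points S. \<forall>y\<in>points S. 0 < \<tau>\<^bsub>S\<^esub> x y \<longleftrightarrow> x \<lless>\<^bsub>S\<^esub> y)"

definition locally_Lipschitz_curve :: "'a metric \<Rightarrow> real set \<Rightarrow> (real \<Rightarrow> 'a) \<Rightarrow> bool" where
  "locally_Lipschitz_curve m I \<gamma> \<longleftrightarrow>
     (\<forall>t\<in>I. \<exists>e>0. Lipschitz_continuous_map (submetric euclidean_metric (I \<inter> ball t e)) m \<gamma>)"

definition monotone_curve ::
  "'a metric \<Rightarrow> ('a \<Rightarrow> 'a \<Rightarrow> bool) \<Rightarrow> real set \<Rightarrow> (real \<Rightarrow> 'a) \<Rightarrow> bool" where
  "monotone_curve m R I \<gamma> \<longleftrightarrow>
     is_interval I \<and> \<gamma> \<in> I \<rightarrow> mspace m \<and> \<not> \<gamma> constant_on I \<and>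
     locally_Lipschitz_curve m I \<gamma> \<and>
     (\<forall>t\<^sub>1\<in>I. \<forall>t\<^sub>2\<in>I. t\<^sub>1 < t\<^sub>2 \<longrightarrow> R (\<gamma> t\<^sub>1) (\<gamma> t\<^sub>2))"

definition future_causal_curve :: "'a lorentzian \<Rightarrow> real set \<Rightarrow> (real \<Rightarrow> 'a) \<Rightarrow> bool" where
  "future_causal_curve S = monotone_curve (lmetric S) (\<lambda>x y. x \<preceq>\<^bsub>S\<^esub> y)"

definition past_causal_curve :: "'a lorentzian \<Rightarrow> real set \<Rightarrow> (real \<Rightarrow> 'a) \<Rightarrow> bool" where
  "past_causal_curve S = monotone_curve (lmetric S) (\<lambda>x y. y \<preceq>\<^bsub>S\<^esub> x)"

definition future_timelike_curve :: "'a lorentzian \<Rightarrow> real set \<Rightarrow> (real \<Rightarrow> 'a) \<Rightarrow> bool" where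
  "future_timelike_curve S = monotone_curve (lmetric S) (\<lambda>x y. x \<lless>\<^bsub>S\<^esub> y)"

definition past_timelike_curve :: "'a lorentzian \<Rightarrow> real set \<Rightarrow> (real \<Rightarrow> 'a) \<Rightarrow> bool" where
  "past_timelike_curve S = monotone_curve (lmetric S) (\<lambda>x y. y \<lless>\<^bsub>S\<^esub> x)"

definition causal_curve :: "'a lorentzian \<Rightarrow> real set \<Rightarrow> (real \<Rightarrow> 'a) \<Rightarrow> bool" where
  "causal_curve S I \<gamma> \<longleftrightarrow> future_causal_curve S I \<gamma> \<or> past_causal_curve S I \<gamma>"

definition timelike_curve :: "'a lorentzian \<Rightarrow> real set \<Rightarrow> (real \<Rightarrow> 'a) \<Rightarrow> bool" where
  "timelike_curve S I \<gamma> \<longleftrightarrow> future_timelike_curve S I \<gamma> \<or> past_timelike_curve S I \<gamma>"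

(* The partition starts (ends) at the left (right) end point of I exactly when that end point
   belongs to I.  At least two points are required: otherwise half-open and open intervals would
   admit a partition with empty sum. *)
definition interval_partition :: "real set \<Rightarrow> nat \<Rightarrow> (nat \<Rightarrow> real) \<Rightarrow> bool" where
  "interval_partition I N t \<longleftrightarrow>
     1 \<le> N \<and> strict_mono_on {..N} t \<and> t ` {..N} \<subseteq> I \<and>
     (\<forall>a\<in>I. (\<forall>s\<in>I. a \<le> s) \<longrightarrow> t 0 = a) \<and>
     (\<forall>b\<in>I. (\<forall>s\<in>I. s \<le> b) \<longrightarrow> t N = b)"

definition tau_length :: "'a lorentzian \<Rightarrow> real set \<Rightarrow> (real \<Rightarrow> 'a) \<Rightarrow> ennreal" where
  "tau_length S I \<gamma> =
     Inf {\<Sum>i<N. \<tau>\<^bsub>S\<^esub> (\<gamma> (t i)) (\<gamma> (t (Suc i))) | N t. interval_partition I N t}"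

(* The length of a past-directed curve: the later parameter is the causally earlier point. *)
definition past_tau_length :: "'a lorentzian \<Rightarrow> real set \<Rightarrow> (real \<Rightarrow> 'a) \<Rightarrow> ennreal" where
  "past_tau_length S I \<gamma> =
     Inf {\<Sum>i<N. \<tau>\<^bsub>S\<^esub> (\<gamma> (t (Suc i))) (\<gamma> (t i)) | N t. interval_partition I N t}"

definition metric_length :: "'a metric \<Rightarrow> real set \<Rightarrow> (real \<Rightarrow> 'a) \<Rightarrow> ennreal" where
  "metric_length m I \<gamma> =
     Sup {\<Sum>i<N. ennreal (mdist m (\<gamma> (t i)) (\<gamma> (t (Suc i)))) | N t. interval_partition I N t}"

(* Non-constancy forces a < b in the following two definitions. *)
definition future_causal_from_to ::
  "'a lorentzian \<Rightarrow> 'a \<Rightarrow> 'a \<Rightarrow> real \<Rightarrow> real \<Rightarrow> (real \<Rightarrow> 'a) \<Rightarrow> bool" where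
  "future_causal_from_to S x y a b \<gamma> \<longleftrightarrow>
     future_causal_curve S {a..b} \<gamma> \<and> \<gamma> a = x \<and> \<gamma> b = y"

definition future_timelike_from_to ::
  "'a lorentzian \<Rightarrow> 'a \<Rightarrow> 'a \<Rightarrow> real \<Rightarrow> real \<Rightarrow> (real \<Rightarrow> 'a) \<Rightarrow> bool" where
  "future_timelike_from_to S x y a b \<gamma> \<longleftrightarrow>
     future_timelike_curve S {a..b} \<gamma> \<and> \<gamma> a = x \<and> \<gamma> b = y"

definition maximal_in ::
  "'a lorentzian \<Rightarrow> 'a set \<Rightarrow> 'a \<Rightarrow> 'a \<Rightarrow> real \<Rightarrow> real \<Rightarrow> (real \<Rightarrow> 'a) \<Rightarrow> bool" where
  "maximal_in S \<Omega> p q a b \<gamma> \<longleftrightarrow>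
     future_causal_from_to S p q a b \<gamma> \<and> \<gamma> ` {a..b} \<subseteq> \<Omega> \<and>
     (\<forall>a' b' \<sigma>. future_causal_from_to S p q a' b' \<sigma> \<and> \<sigma> ` {a'..b'} \<subseteq> \<Omega> \<longrightarrow>
        tau_length S {a'..b'} \<sigma> \<le> tau_length S {a..b} \<gamma>)"

definition localising_neighbourhood :: "'a lorentzian \<Rightarrow> 'a set \<Rightarrow> bool" where
  "localising_neighbourhood S \<Omega> \<longleftrightarrow>
     openin (ltop S) \<Omega> \<and>
     (\<exists>C::real. \<forall>I \<gamma>. causal_curve S I \<gamma> \<and> \<gamma> ` I \<subseteq> \<Omega> \<longrightarrow>
        metric_length (lmetric S) I \<gamma> \<le> ennreal C) \<and>
     (\<exists>\<omega> :: 'a \<Rightarrow> 'a \<Rightarrow> real.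
        (\<forall>p\<in>\<Omega>. \<forall>q\<in>\<Omega>. 0 \<le> \<omega> p q) \<and>
        continuous_map (prod_topology (subtopology (ltop S) \<Omega>) (subtopology (ltop S) \<Omega>))
          euclideanreal (\<lambda>(p, q). \<omega> p q) \<and>
        lorentzian_pre_length_space
          (S\<lparr>lmetric := submetric (lmetric S) \<Omega>, tsep := \<lambda>p q. ennreal (\<omega> p q)\<rparr>) \<and>
        (\<forall>y\<in>\<Omega>. chron_future S y \<inter> \<Omega> \<noteq> {} \<and> chron_past S y \<inter> \<Omega> \<noteq> {}) \<and>
        (\<forall>p\<in>\<Omega>. \<forall>q\<in>\<Omega>. p \<preceq>\<^bsub>S\<^esub> q \<and> p \<noteq> q \<longrightarrow>
           (\<exists>a b \<gamma>. maximal_in S \<Omega> p q a b \<gamma> \<and>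
              tau_length S {a..b} \<gamma> = ennreal (\<omega> p q) \<and> ennreal (\<omega> p q) \<le> \<tau>\<^bsub>S\<^esub> p q)))"

definition localisable :: "'a lorentzian \<Rightarrow> bool" where
  "localisable S \<longleftrightarrow> (\<forall>x\<in>points S. \<exists>\<Omega>. x \<in> \<Omega> \<and> localising_neighbourhood S \<Omega>)"

definition causally_path_connected :: "'a lorentzian \<Rightarrow> bool" where
  "causally_path_connected S \<longleftrightarrow>
     (\<forall>x\<in>points S. \<forall>y\<in>points S.
        (x \<lless>\<^bsub>S\<^esub> y \<longrightarrow> (\<exists>a b \<gamma>. future_timelike_from_to S x y a b \<gamma>)) \<and>
        (x \<preceq>\<^bsub>S\<^esub> y \<and> x \<noteq> y \<longrightarrow> (\<exists>a b \<gamma>. future_causal_from_to S x y a b \<gamma>)))"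

definition locally_causally_closed :: "'a lorentzian \<Rightarrow> bool" where
  "locally_causally_closed S \<longleftrightarrow>
     (\<forall>x\<in>points S. \<exists>U V. U \<subseteq> points S \<and> openin (ltop S) V \<and> x \<in> V \<and> V \<subseteq> U \<and>
        (let K = ltop S closure_of U in
           closedin (prod_topology (subtopology (ltop S) K) (subtopology (ltop S) K))
             {(p, q). p \<in> K \<and> q \<in> K \<and> p \<preceq>\<^bsub>S\<^esub> q}))"

(* If there is no future-directed causal curve from x to y this is Sup {} = 0. *)
definition intrinsic_tsep :: "'a lorentzian \<Rightarrow> 'a \<Rightarrow> 'a \<Rightarrow> ennreal" where
  "intrinsic_tsep S x y = Sup {tau_length S {a..b} \<gamma> | a b \<gamma>. future_causal_from_to S x y a b \<gamma>}"

definition lorentzian_length_space :: "'a lorentzian \<Rightarrow> bool" where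
  "lorentzian_length_space S \<longleftrightarrow>
     lorentzian_pre_length_space S \<and> locally_causally_closed S \<and>
     causally_path_connected S \<and> localisable S \<and>
     (\<forall>x\<in>points S. \<forall>y\<in>points S. \<tau>\<^bsub>S\<^esub> x y = intrinsic_tsep S x y)"

(* "Timelike" and "causal" without a direction mean future- or past-directed, so the equivalences
   do not by themselves compare time orientations. *)
definition lorentzian_extension ::
  "'a lorentzian \<Rightarrow> 'b lorentzian \<Rightarrow> ('a \<Rightarrow> 'b) \<Rightarrow> bool" where
  "lorentzian_extension S T \<iota> \<longleftrightarrow>
     lorentzian_pre_length_space S \<and> lorentzian_pre_length_space T \<and>
     connected_space (ltop T) \<and>
     \<iota> \<in> points S \<rightarrow> points T \<and>
     (\<forall>x\<in>points S. \<forall>y\<in>points S. mdist (lmetric T) (\<iota> x) (\<iota> y) = mdist (lmetric S) x y) \<and>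
     openin (ltop T) (\<iota> ` points S) \<and> \<iota> ` points S \<subset> points T \<and>
     (\<forall>x\<in>points S. \<forall>y\<in>points S.
        (x \<preceq>\<^bsub>S\<^esub> y \<longrightarrow> \<iota> x \<preceq>\<^bsub>T\<^esub> \<iota> y) \<and> (x \<lless>\<^bsub>S\<^esub> y \<longrightarrow> \<iota> x \<lless>\<^bsub>T\<^esub> \<iota> y)) \<and>
     (\<forall>I \<gamma>. is_interval I \<and> \<gamma> \<in> I \<rightarrow> points S \<longrightarrow>
        (timelike_curve S I \<gamma> \<longleftrightarrow> timelike_curve T I (\<iota> \<circ> \<gamma>)) \<and>
        (causal_curve S I \<gamma> \<longleftrightarrow> causal_curve T I (\<iota> \<circ> \<gamma>)) \<and>
        (future_causal_curve S I \<gamma> \<longrightarrow> tau_length S I \<gamma> = tau_length T I (\<iota> \<circ> \<gamma>)) \<and>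
        (past_causal_curve S I \<gamma> \<longrightarrow> past_tau_length S I \<gamma> = past_tau_length T I (\<iota> \<circ> \<gamma>)))"

definition future_boundary :: "'a lorentzian \<Rightarrow> 'b lorentzian \<Rightarrow> ('a \<Rightarrow> 'b) \<Rightarrow> 'b set" where
  "future_boundary S T \<iota> =
     {p \<in> ltop T frontier_of (\<iota> ` points S).
        \<exists>\<gamma>. future_timelike_curve T {0..1} \<gamma> \<and> \<gamma> ` {0..<1} \<subseteq> \<iota> ` points S \<and> \<gamma> 1 = p}"

definition past_boundary :: "'a lorentzian \<Rightarrow> 'b lorentzian \<Rightarrow> ('a \<Rightarrow> 'b) \<Rightarrow> 'b set" where
  "past_boundary S T \<iota> =
     {p \<in> ltop T frontier_of (\<iota> ` points S).
        \<exists>\<gamma>. past_timelike_curve T {0..1} \<gamma> \<and> \<gamma> ` {0..<1} \<subseteq> \<iota> ` points S \<and> \<gamma> 1 = p}"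

end

theory Submission
  imports Defs
begin

text \<open>Write \<open>A\<close> for the image of \<open>X\<close>, an open, nonempty, proper subset of the connected space
  \<open>X'\<close>. By connectedness \<open>A\<close> has a frontier point \<open>p\<close>, and localisability puts some point
  \<open>q\<close> in its chronological past. The chronological future of \<open>q\<close> is open by lower
  semicontinuity of the time separation, and it contains \<open>p\<close>, so it contains points both
  outside and inside \<open>A\<close>. Hence some chronologically related pair is separated by \<open>A\<close>
  (\<open>chronological_pair_across_open_set\<close>), and causal path connectedness joins it by a timelike
  curve.

  Follow this curve from its end point in \<open>A\<close> towards its end point outside \<open>A\<close>, against its
  direction if need be, and stop at the first parameter where it is no longer in \<open>A\<close>
  (\<open>monotone_curve_first_exit\<close>). The point reached there is a frontier point of \<open>A\<close>, in the
  future boundary or the past boundary according to the direction of travel. Which of the two occurs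
  depends on the side of \<open>A\<close> that \<open>q\<close> lies on.\<close>

lemma locally_Lipschitz_curve_continuous:
  assumes "locally_Lipschitz_curve m I \<gamma>"
  shows "continuous_map (top_of_set I) (mtopology_of m) \<gamma>"
proof -
  have local: "continuous_map (top_of_set (I \<inter> ball t e)) (mtopology_of m) \<gamma>"
    if "Lipschitz_continuous_map (submetric euclidean_metric (I \<inter> ball t e)) m \<gamma>" for t e
    using Lipschitz_continuous_imp_continuous_map[OF that]
    by (simp add: mtopology_of_submetric)
  show ?thesis
    unfolding continuous_map_def
  proof (intro conjI allI impI)
    show "\<gamma> \<in> topspace (top_of_set I) \<rightarrow> topspace (mtopology_of m)"
    proof
      fix t assume "t \<in> topspace (top_of_set I)"
      then have "t \<in> I" by simp
      then obtain e where "e > 0"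
        and "Lipschitz_continuous_map (submetric euclidean_metric (I \<inter> ball t e)) m \<gamma>"
        using assms unfolding locally_Lipschitz_curve_def by blast
      then show "\<gamma> t \<in> topspace (mtopology_of m)"
        using local[THEN continuous_map_funspace] \<open>t \<in> I\<close> by fastforce
    qed
  next
    fix U assume U: "openin (mtopology_of m) U"
    show "openin (top_of_set I) {t \<in> topspace (top_of_set I). \<gamma> t \<in> U}"
    proof (subst openin_subopen, intro ballI)
      fix t assume t: "t \<in> {t \<in> topspace (top_of_set I). \<gamma> t \<in> U}"
      then obtain e where "e > 0"
        and e: "Lipschitz_continuous_map (submetric euclidean_metric (I \<inter> ball t e)) m \<gamma>"
        using assms unfolding locally_Lipschitz_curve_def by auto
      have "openin (top_of_set (I \<inter> ball t e)) {s \<in> I \<inter> ball t e. \<gamma> s \<in> U}"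
        using openin_continuous_map_preimage[OF local[OF e] U] by simp
      then have "openin (top_of_set I) {s \<in> I \<inter> ball t e. \<gamma> s \<in> U}"
        by (rule openin_trans) (simp add: openin_open_Int)
      with t \<open>e > 0\<close> show "\<exists>V. openin (top_of_set I) V \<and> t \<in> V \<and>
          V \<subseteq> {t \<in> topspace (top_of_set I). \<gamma> t \<in> U}"
        by (intro exI[of _ "{s \<in> I \<inter> ball t e. \<gamma> s \<in> U}"]) auto
    qed
  qed
qed

lemma locally_Lipschitz_curve_affine_reparametrisation:
  assumes \<gamma>: "locally_Lipschitz_curve m I \<gamma>"
    and "d \<noteq> 0" and maps: "\<And>s. s \<in> J \<Longrightarrow> c + s * d \<in> I"
  shows "locally_Lipschitz_curve m J (\<lambda>s. \<gamma> (c + s * d))"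
  unfolding locally_Lipschitz_curve_def
proof
  fix s assume "s \<in> J"
  then obtain e where "e > 0"
    and e: "Lipschitz_continuous_map (submetric euclidean_metric (I \<inter> ball (c + s * d) e)) m \<gamma>"
    using \<gamma> maps unfolding locally_Lipschitz_curve_def by blast
  have dist: "dist (c + x * d) (c + y * d) = \<bar>d\<bar> * dist x y" for x y
    by (simp add: dist_real_def flip: abs_mult) (simp add: algebra_simps)
  have "Lipschitz_continuous_map (submetric euclidean_metric (J \<inter> ball s (e / \<bar>d\<bar>)))
      (submetric euclidean_metric (I \<inter> ball (c + s * d) e)) (\<lambda>s. c + s * d)"
    using maps \<open>d \<noteq> 0\<close>
    by (auto simp: Lipschitz_continuous_map_def dist pos_less_divide_eq mult.commute[of _ "\<bar>d\<bar>"]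
        simp del: dist_add_cancel intro!: exI[of _ "\<bar>d\<bar>"])
  from Lipschitz_continuous_map_compose[OF this e]
  show "\<exists>e>0. Lipschitz_continuous_map (submetric euclidean_metric (J \<inter> ball s e)) m
      (\<lambda>s. \<gamma> (c + s * d))"
    using \<open>e > 0\<close> \<open>d \<noteq> 0\<close> by (intro exI[of _ "e / \<bar>d\<bar>"]) (simp add: o_def)
qed

text \<open>Traversing a curve from parameter \<open>u\<close> to parameter \<open>w\<close> at constant speed preserves its
  direction when \<open>u < w\<close> and reverses it when \<open>w < u\<close>, which turns a future directed curve into
  a past directed one.\<close>

lemma monotone_curve_segment:
  assumes \<gamma>: "monotone_curve m R I \<gamma>" and "u \<in> I" "w \<in> I" and distinct: "\<gamma> u \<noteq> \<gamma> w"
  shows "monotone_curve m (if u < w then R else R\<inverse>\<inverse>) {0..1} (\<lambda>s. \<gamma> (u + s * (w - u)))"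
proof -
  have maps: "u + s * (w - u) \<in> I" if "s \<in> {0..1}" for s
  proof -
    have "convex I"
      using \<gamma> by (simp add: monotone_curve_def is_interval_convex)
    then have "(1 - s) *\<^sub>R u + s *\<^sub>R w \<in> I"
      using assms that by (intro convexD) auto
    then show ?thesis by (simp add: algebra_simps)
  qed
  have "\<not> (\<lambda>s. \<gamma> (u + s * (w - u))) constant_on {0..1}"
  proof
    assume "(\<lambda>s. \<gamma> (u + s * (w - u))) constant_on {0..1}"
    then obtain y where "\<forall>s\<in>{0..1}. \<gamma> (u + s * (w - u)) = y"
      by (auto simp: constant_on_def)
    from this[rule_format, of 0] this[rule_format, of 1] distinct show False by simp
  qed
  moreover have "u \<noteq> w" using distinct by auto
  moreover have "(if u < w then R else R\<inverse>\<inverse>) (\<gamma> (u + s * (w - u))) (\<gamma> (u + t * (w - u)))"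
    if "s \<in> {0..1}" "t \<in> {0..1}" "s < t" for s t
    using \<gamma> maps[OF that(1)] maps[OF that(2)] that(3) \<open>u \<noteq> w\<close>
    by (auto simp: monotone_curve_def)
  ultimately show ?thesis
    using \<gamma> maps locally_Lipschitz_curve_affine_reparametrisation[of m I \<gamma> "w - u" "{0..1}" u]
    by (auto simp: monotone_curve_def is_interval_cc)
qed

text \<open>The parameters outside the open set form a nonempty closed set, whose infimum is attained.
  Hence the exit time itself is already outside.\<close>

lemma first_exit_time:
  fixes \<sigma> :: "real \<Rightarrow> 'a"
  assumes \<sigma>: "continuous_map (top_of_set {0..1}) T \<sigma>" and A: "openin T A"
    and start: "\<sigma> 0 \<in> A" and finish: "\<sigma> 1 \<notin> A"
  obtains s where "0 < s" "s \<le> 1" "\<sigma> ` {0..<s} \<subseteq> A" "\<sigma> s \<notin> A"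
proof -
  define E where "E = {t \<in> {0..1}. \<sigma> t \<in> topspace T - A}"
  have "closedin (top_of_set {0..1}) E"
    unfolding E_def
    using closedin_continuous_map_preimage[OF \<sigma>, of "topspace T - A"] A
    by (simp add: closedin_diff)
  then have "closed E"
    using closed_atLeastAtMost closedin_closed_trans by blast
  have outside: "t \<in> E \<longleftrightarrow> t \<in> {0..1} \<and> \<sigma> t \<notin> A" for t
    using continuous_map_funspace[OF \<sigma>] by (auto simp: E_def)
  have "1 \<in> E" using finish by (simp add: outside)
  have "bdd_below E" by (rule bdd_belowI[of _ 0]) (simp add: outside)
  have "Inf E \<in> E"
    using \<open>closed E\<close> \<open>1 \<in> E\<close> \<open>bdd_below E\<close> by (intro closed_contains_Inf) auto
  moreover have "\<sigma> t \<in> A" if "t \<in> {0..<Inf E}" for t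
    using that \<open>Inf E \<in> E\<close> cInf_lower[OF _ \<open>bdd_below E\<close>, of t] by (force simp: outside)
  moreover have "Inf E \<noteq> 0" using \<open>Inf E \<in> E\<close> start by (auto simp: outside)
  ultimately show thesis
    by (intro that[of "Inf E"]) (auto simp: outside)
qed

text \<open>The parameters \<open>u\<close> and \<open>v\<close> come in either order, so that one statement covers leaving
  \<open>A\<close> towards the future and towards the past.\<close>

lemma monotone_curve_first_exit:
  assumes \<gamma>: "monotone_curve m R I \<gamma>" and A: "openin (mtopology_of m) A"
    and "u \<in> I" "v \<in> I" and start: "\<gamma> u \<in> A" and finish: "\<gamma> v \<notin> A"
  obtains \<sigma> where "monotone_curve m (if u < v then R else R\<inverse>\<inverse>) {0..1} \<sigma>"
    and "\<sigma> ` {0..<1} \<subseteq> A" and "\<sigma> 1 \<in> mtopology_of m frontier_of A - A"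
proof -
  have "\<gamma> u \<noteq> \<gamma> v" using start finish by auto
  then have "monotone_curve m (if u < v then R else R\<inverse>\<inverse>) {0..1} (\<lambda>s. \<gamma> (u + s * (v - u)))"
    (is "monotone_curve m ?R _ ?\<rho>")
    using monotone_curve_segment[OF \<gamma>] assms by blast
  then have \<rho>: "monotone_curve m ?R {0..1} ?\<rho>"
    and cont: "continuous_map (top_of_set {0..1}) (mtopology_of m) ?\<rho>"
    by (simp_all add: monotone_curve_def locally_Lipschitz_curve_continuous)
  obtain s where s: "0 < s" "s \<le> 1" "?\<rho> ` {0..<s} \<subseteq> A" "?\<rho> s \<notin> A"
    using first_exit_time[OF cont A] start finish by auto
  \<comment> \<open>The form matches the segment of \<open>?\<rho>\<close> from \<open>0\<close> to the exit time.\<close>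
  define \<sigma> where "\<sigma> = (\<lambda>t. ?\<rho> (0 + t * (s - 0)))"
  have "?\<rho> 0 \<noteq> ?\<rho> s" using s(4) start by auto
  then have \<sigma>: "monotone_curve m ?R {0..1} \<sigma>"
    using monotone_curve_segment[OF \<rho>, of 0 s] s unfolding \<sigma>_def by auto
  have inside: "\<sigma> ` {0..<1} \<subseteq> A"
    using s by (auto simp: \<sigma>_def image_subset_iff)
  have "continuous_map (top_of_set {0..1}) (mtopology_of m) \<sigma>"
    using \<sigma> by (simp add: monotone_curve_def locally_Lipschitz_curve_continuous)
  then have "\<sigma> ` (top_of_set {0..1} closure_of {0..<1}) \<subseteq> mtopology_of m closure_of (\<sigma> ` {0..<1})"
    by (rule continuous_map_image_closure_subset)
  moreover have "(1::real) \<in> top_of_set {0..1} closure_of {0..<1}"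
    by (simp add: closure_of_subtopology Int_absorb1 atLeastLessThan_subseteq_atLeastAtMost_iff)
  ultimately have "\<sigma> 1 \<in> mtopology_of m closure_of A"
    using closure_of_mono[OF inside, of "mtopology_of m"] by blast
  moreover have "\<sigma> 1 \<notin> A" using s by (simp add: \<sigma>_def)
  ultimately show thesis
    using that \<sigma> inside A by (simp add: frontier_of_def interior_of_openin)
qed

text \<open>Positivity of the time separation characterises the chronological relation, so lower
  semicontinuity makes that relation open.\<close>

lemma openin_chron_future:
  assumes S: "lorentzian_pre_length_space S" and "x \<in> points S"
  shows "openin (ltop S) (chron_future S x)"
proof -
  have "openin (prod_topology (ltop S) (ltop S))
      {z \<in> points S \<times> points S. 0 < (case z of (x, y) \<Rightarrow> \<tau>\<^bsub>S\<^esub> x y)}"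
    using S unfolding lorentzian_pre_length_space_def lower_semicontinuous_map_def by simp
  moreover have "continuous_map (ltop S) (prod_topology (ltop S) (ltop S)) (\<lambda>y. (x, y))"
    using \<open>x \<in> points S\<close> by (simp add: continuous_map_pairedI)
  ultimately have "openin (ltop S) {y \<in> points S. 0 < \<tau>\<^bsub>S\<^esub> x y}"
    using \<open>x \<in> points S\<close> by (auto dest: openin_continuous_map_preimage)
  moreover have "{y \<in> points S. 0 < \<tau>\<^bsub>S\<^esub> x y} = chron_future S x"
    using S \<open>x \<in> points S\<close> unfolding lorentzian_pre_length_space_def chron_future_def by auto
  ultimately show ?thesis by simp
qed

text \<open>A point \<open>q\<close> in the past of a frontier point \<open>p\<close> sees a whole neighbourhood of \<open>p\<close> in its
  future, hence points on both sides of \<open>A\<close>: the point \<open>p\<close> itself outside \<open>A\<close> and some \<open>r\<close>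
  inside. Whichever side \<open>q\<close> lies on, one of \<open>p\<close> and \<open>r\<close> lies on the other.\<close>

lemma chronological_pair_across_open_set:
  assumes S: "lorentzian_length_space S" and conn: "connected_space (ltop S)"
    and A: "openin (ltop S) A" "A \<noteq> {}" "A \<noteq> points S"
  obtains x y where "x \<in> points S" "y \<in> points S" "x \<lless>\<^bsub>S\<^esub> y" "x \<in> A \<longleftrightarrow> y \<notin> A"
proof -
  have "A \<subseteq> points S" using openin_subset[OF A(1)] by simp
  then have "ltop S frontier_of A \<noteq> {}"
    using conn A connected_space_frontier_eq_empty[of "ltop S" A] by auto
  then obtain p where p: "p \<in> ltop S closure_of A" "p \<notin> A"
    using A(1) by (auto simp: frontier_of_def interior_of_openin)
  then have "p \<in> points S" by (auto simp: in_closure_of)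
  then obtain \<Omega> where "p \<in> \<Omega>" "localising_neighbourhood S \<Omega>"
    using S by (auto simp: lorentzian_length_space_def localisable_def)
  then have "chron_past S p \<noteq> {}"
    unfolding localising_neighbourhood_def by blast
  then obtain q where q: "q \<in> points S" "q \<lless>\<^bsub>S\<^esub> p"
    by (auto simp: chron_past_def)
  have "openin (ltop S) (chron_future S q)"
    using S q by (simp add: lorentzian_length_space_def openin_chron_future)
  moreover have "p \<in> chron_future S q"
    using q \<open>p \<in> points S\<close> by (simp add: chron_future_def)
  ultimately obtain r where "r \<in> A" "r \<in> chron_future S q"
    using p(1) unfolding in_closure_of by blast
  then have "r \<in> A" "r \<in> points S" "q \<lless>\<^bsub>S\<^esub> r"
    by (simp_all add: chron_future_def)
  with q p \<open>p \<in> points S\<close> that show thesis by blast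
qed

theorem lemma3p8:
  fixes X :: "'a lorentzian" and X' :: "'b lorentzian" and \<iota> :: "'a \<Rightarrow> 'b"
  assumes "lorentzian_length_space X"
    and "lorentzian_length_space X'"
    and "lorentzian_extension X X' \<iota>"
  shows "(\<exists>\<gamma>. timelike_curve X' {0..1} \<gamma> \<and> \<gamma> ` {0..<1} \<subseteq> \<iota> ` points X \<and>
            \<gamma> 1 \<in> points X' - \<iota> ` points X)
    \<and> future_boundary X X' \<iota> \<union> past_boundary X X' \<iota> \<noteq> {}"
proof -
  define A where "A = \<iota> ` points X"
  have A: "openin (ltop X') A" "A \<noteq> {}" "A \<noteq> points X'" and conn: "connected_space (ltop X')"
    using assms(3)
    by (auto simp: A_def lorentzian_extension_def lorentzian_pre_length_space_def causal_space_def)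
  obtain x y where xy: "x \<in> points X'" "y \<in> points X'" "x \<lless>\<^bsub>X'\<^esub> y" "x \<in> A \<longleftrightarrow> y \<notin> A"
    using chronological_pair_across_open_set[OF assms(2) conn A] by blast
  then obtain a b \<gamma> where ends: "\<gamma> a = x" "\<gamma> b = y"
    and \<gamma>: "monotone_curve (lmetric X') (chron X') {a..b} \<gamma>"
    using assms(2)
    unfolding lorentzian_length_space_def causally_path_connected_def
      future_timelike_from_to_def future_timelike_curve_def by blast
  \<comment> \<open>The order of the parameters decides between the two time directions below.\<close>
  have "a < b"
  proof -
    have "{a..b} \<noteq> {}" using \<gamma> by (auto simp: monotone_curve_def constant_on_def)
    moreover have "a \<noteq> b" using ends xy(4) by auto
    ultimately show ?thesis by simp
  qed
  have exit: "\<exists>\<sigma>. (future_timelike_curve X' {0..1} \<sigma> \<or> past_timelike_curve X' {0..1} \<sigma>) \<and>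
      \<sigma> ` {0..<1} \<subseteq> A \<and> \<sigma> 1 \<in> ltop X' frontier_of A - A"
  proof (cases "x \<in> A")
    case True
    then obtain \<sigma> where "monotone_curve (lmetric X') (chron X') {0..1} \<sigma>"
      "\<sigma> ` {0..<1} \<subseteq> A" "\<sigma> 1 \<in> ltop X' frontier_of A - A"
      using monotone_curve_first_exit[OF \<gamma> A(1), of a b] xy(4) ends \<open>a < b\<close> by auto
    then show ?thesis by (auto simp: future_timelike_curve_def)
  next
    case False
    then obtain \<sigma> where "monotone_curve (lmetric X') (chron X')\<inverse>\<inverse> {0..1} \<sigma>"
      "\<sigma> ` {0..<1} \<subseteq> A" "\<sigma> 1 \<in> ltop X' frontier_of A - A"
      using monotone_curve_first_exit[OF \<gamma> A(1), of b a] xy(4) ends \<open>a < b\<close> by auto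
    moreover have "(chron X')\<inverse>\<inverse> = (\<lambda>x y. y \<lless>\<^bsub>X'\<^esub> x)" by auto
    ultimately show ?thesis by (auto simp: past_timelike_curve_def)
  qed
  then obtain \<sigma> where \<sigma>: "timelike_curve X' {0..1} \<sigma>" "\<sigma> ` {0..<1} \<subseteq> A"
      "\<sigma> 1 \<in> ltop X' frontier_of A" "\<sigma> 1 \<notin> A"
    by (auto simp: timelike_curve_def)
  moreover have "\<sigma> 1 \<in> points X'"
    using \<sigma>(3) frontier_of_subset_topspace[of "ltop X'" A] by auto
  moreover have "\<sigma> 1 \<in> future_boundary X X' \<iota> \<union> past_boundary X X' \<iota>"
    using \<sigma> by (auto simp: timelike_curve_def future_boundary_def past_boundary_def A_def)
  ultimately show ?thesis unfolding A_def by blast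
qed

end
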